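(* Let $(z,\bar z)$ be the complexified normal form coordinates in the local polydisc $\mathcal{D}_a$, where $z_i=x_i+\mathrm{i}y_i$, $i=1,\dots,n$. For each degree of freedom $i=1,\dots,n$ define the orbital radius in the $i$-th phase plane by $r_i^2=z_i\bar z_i$. Let the discrete Poincaré map in normal form coordinates be $G^{(N_{\mathrm{opt}})}=F^{(N_{\mathrm{opt}})}+R^{(N_{\mathrm{opt}})}$, with $F^{(N_{\mathrm{opt}})}$ the integrable twist map and $R^{(N_{\mathrm{opt}})}$ the remainder. Then the one-step drift in the radius $\Delta r_i:=r_i^{(1)}-r_i^{(0)}$ under $G^{(N_{\mathrm{opt}})}$ satisfies, for any point in $\mathcal{D}_a$, $$|\Delta r_i|\le\|R^{(N_{\mathrm{opt}})}\|_a ,$$ where $\|R^{(N_{\mathrm{opt}})}\|_a$ is bounded by the exponentially small quantity $\epsilon_2\left(\frac{2a}{\rho}\right)\exp(-\tau N_{\mathrm{opt}})$.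
   Context: **Domain and norm.** $\mathcal{D}_a=\{s\in\mathbb{C}^{2n}:|s_i|<a,\ i=1,\dots,2n\}$; points considered have the form $s=(z,\bar z)$ with $z\in\mathbb{C}^n$. For a vector-valued power series $F=(F_1,\dots,F_{2n})$, $F_i=\sum_j c_{j,i}s^j$ (multi-indices $j$), $\|F\|_a=\max_i\sum_j|c_{j,i}|a^{|j|}$. **Twist map.** The normalized part acts as $F_i^{(N_{\mathrm{opt}})}(z,\bar z)=z_i\exp[\mathrm{i}\,\Omega_i(r)]$ for $i=1,\dots,n$, with $\Omega_i(r)$ real-valued and depending only on the radii $r=(r_1,\dots,r_n)$. **Iterate.** For a point $(z^{(0)},\bar z^{(0)})\in\mathcal{D}_a$, $z_i^{(1)}=F_i^{(N_{\mathrm{opt}})}(z^{(0)},\bar z^{(0)})+R_i^{(N_{\mathrm{opt}})}(z^{(0)},\bar z^{(0)})$, and $r_i^{(m)}=|z_i^{(m)}|$ for $m=0,1$. **Standing bound on the remainder.** With constants $\epsilon_2,\rho,\gamma,\tau>0$, $A=\frac4{\rho\gamma}$, $0<a\le\frac1{A(2e)^\tau}$ and $N_{\mathrm{opt}}=\left\lfloor\frac1e\left(\frac1{Aa}\right)^{1/\tau}\right\rfloor$, the remainder at order $N=N_{\mathrm{opt}}$ satisfies $\|R^{(N)}\|_a\le\epsilon_2\left(\frac{2a}\rho\right)(AaN^\tau)^N$. *)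

theory Defs
  imports "HOL-Analysis.Analysis"
begin

text \<open>
  $\mathbb{C}^{2n}$ is \<open>complex ^ ('n + 'n)\<close>: the coordinates \<open>Inl i\<close> are $s_1,\dots,s_n$ and the
  coordinates \<open>Inr i\<close> are $s_{n+1},\dots,s_{2n}$.
\<close>

definition polydisc :: "real \<Rightarrow> (complex ^ 'm) set"
  where "polydisc a = {s. \<forall>k. cmod (s $ k) < a}"

definition complexify :: "complex ^ 'n \<Rightarrow> complex ^ ('n + 'n)"
  where "complexify z = (\<chi> k. case k of Inl i \<Rightarrow> z $ i | Inr i \<Rightarrow> cnj (z $ i))"

definition z_part :: "complex ^ ('n + 'n) \<Rightarrow> complex ^ 'n"
  where "z_part s = (\<chi> i. s $ Inl i)"

definition orbital_radius :: "complex ^ 'n \<Rightarrow> real ^ 'n"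
  where "orbital_radius z = (\<chi> i. cmod (z $ i))"

lemma orbital_radius_squared:
  "complex_of_real ((orbital_radius z $ i)\<^sup>2) = z $ i * cnj (z $ i)"
  by (simp only: orbital_radius_def vec_lambda_beta complex_norm_square)

text \<open>
  A vector-valued power series in the variables indexed by \<open>'m\<close> is given by its coefficients:
  \<open>c k j\<close> is the coefficient of $s^j$ in component \<open>k\<close>.
\<close>

type_synonym 'm power_series = "'m \<Rightarrow> ('m \<Rightarrow> nat) \<Rightarrow> complex"

definition degree_of :: "('m::finite \<Rightarrow> nat) \<Rightarrow> nat"
  where "degree_of j = (\<Sum>l\<in>UNIV. j l)"

definition monomial_at :: "complex ^ 'm \<Rightarrow> ('m::finite \<Rightarrow> nat) \<Rightarrow> complex"
  where "monomial_at s j = (\<Prod>l\<in>UNIV. (s $ l) ^ j l)"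

definition series_eval :: "('m::finite) power_series \<Rightarrow> complex ^ 'm \<Rightarrow> complex ^ 'm"
  where "series_eval c s = (\<chi> k. \<Sum>\<^sub>\<infinity>j\<in>UNIV. c k j * monomial_at s j)"

text \<open>
  The norm takes values in \<^typ>\<open>ennreal\<close>, so that it is \<open>\<infinity>\<close>, and not \<open>0\<close>, on series that do not
  converge absolutely; a finite bound on it thus includes convergence on the polydisc.
\<close>

definition series_norm :: "real \<Rightarrow> ('m::finite) power_series \<Rightarrow> ennreal"
  where "series_norm a c = (MAX k. \<Sum>\<^sub>\<infinity>j\<in>UNIV. ennreal (cmod (c k j) * a ^ degree_of j))"

text \<open>
  Only the first half of the components of the map is prescribed, and only at the points
  $(z,\bar z)$ of the polydisc.
\<close>

definition twist_map_on ::
    "real \<Rightarrow> (real ^ 'n \<Rightarrow> real ^ 'n) \<Rightarrow> (complex ^ ('n + 'n) \<Rightarrow> complex ^ ('n + 'n)) \<Rightarrow> bool"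
  where "twist_map_on a \<Omega> F \<longleftrightarrow>
    (\<forall>z. complexify z \<in> polydisc a \<longrightarrow>
      (\<forall>i. F (complexify z) $ Inl i
            = z $ i * exp (\<i> * complex_of_real (\<Omega> (orbital_radius z) $ i))))"

definition radial_drift ::
    "(complex ^ ('n + 'n) \<Rightarrow> complex ^ ('n + 'n)) \<Rightarrow> complex ^ 'n \<Rightarrow> 'n \<Rightarrow> real"
  where "radial_drift G z i =
    orbital_radius (z_part (G (complexify z))) $ i - orbital_radius z $ i"

end

theory Submission
  imports Defs
begin

text \<open>The twist map multiplies each z_i by a phase of modulus one, so it preserves every
  radius; the drift is |F_i + R_i| - |F_i|, and the reverse triangle inequality bounds it by |R_i|
  (\<open>abs_radial_drift_le\<close>). On the polydisc each monomial s^j is at most a^|j| in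
  modulus, so summing termwise bounds |R_i| by the norm of the series
  (\<open>cmod_series_eval_le\<close>). The exponential rate comes from the choice of order: N is at
  most (1/e) (1/(Aa))^(1/\<tau>), which says exactly that A a N^\<tau> is at most exp(-\<tau>), and
  the N-th power gives exp(-\<tau> N) (\<open>optimal_order_power_le\<close>).\<close>

text \<open>Over the complex numbers summability is absolute summability, so the usual norm bound
  applies whenever the series converges. Passing to \<open>ennreal\<close> allows the triangle
  inequality to be stated with no convergence hypothesis.\<close>

lemma norm_infsum_le_infsum_ennreal:
  fixes f :: "'b \<Rightarrow> complex"
  shows "ennreal (cmod (infsum f A)) \<le> (\<Sum>\<^sub>\<infinity>x\<in>A. ennreal (cmod (f x)))"
proof (cases "f summable_on A")
  case True
  then have abs: "(\<lambda>x. cmod (f x)) summable_on A"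
    by (simp add: summable_on_iff_abs_summable_on_complex)
  have "((\<lambda>X. \<Sum>x\<in>X. cmod (f x)) \<longlongrightarrow> (\<Sum>\<^sub>\<infinity>x\<in>A. cmod (f x))) (finite_subsets_at_top A)"
    using has_sum_infsum[OF abs] by (simp add: has_sum_def)
  then have "((\<lambda>X. ennreal (\<Sum>x\<in>X. cmod (f x))) \<longlongrightarrow> ennreal (\<Sum>\<^sub>\<infinity>x\<in>A. cmod (f x)))
      (finite_subsets_at_top A)"
    \<comment> \<open>Continuity of \<open>ennreal\<close> carries the limit of the finite partial
      sums over, so the real and the extended sum agree.\<close>
    by (rule tendsto_ennrealI)
  then have "((\<lambda>x. ennreal (cmod (f x))) has_sum ennreal (\<Sum>\<^sub>\<infinity>x\<in>A. cmod (f x))) A"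
    by (simp add: has_sum_def flip: sum_ennreal)
  then have "(\<Sum>\<^sub>\<infinity>x\<in>A. ennreal (cmod (f x))) = ennreal (\<Sum>\<^sub>\<infinity>x\<in>A. cmod (f x))"
    by (rule infsumI)
  then show ?thesis
    using norm_infsum_bound[OF abs] by (simp add: ennreal_leI)
next
  case False
  \<comment> \<open>A family that is not summable has \<open>infsum\<close> equal to 0 by
    convention, so the left side vanishes.\<close>
  then show ?thesis by (simp add: infsum_not_exists)
qed

lemma cmod_monomial_at_le:
  fixes s :: "complex ^ 'm::finite"
  assumes "s \<in> polydisc a"
  shows "cmod (monomial_at s j) \<le> a ^ degree_of j"
proof -
  have "cmod (monomial_at s j) = (\<Prod>l\<in>UNIV. cmod (s $ l) ^ j l)"
    by (simp add: monomial_at_def prod_norm[symmetric] norm_power)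
  also have "\<dots> \<le> (\<Prod>l\<in>UNIV. a ^ j l)"
    using assms by (intro prod_mono conjI power_mono zero_le_power) (auto simp: polydisc_def less_imp_le)
  also have "\<dots> = a ^ degree_of j"
    by (simp add: degree_of_def power_sum)
  finally show ?thesis .
qed

lemma cmod_series_eval_le:
  fixes s :: "complex ^ 'm::finite"
  assumes "s \<in> polydisc a"
  shows "ennreal (cmod (series_eval c s $ k)) \<le> series_norm a c"
proof -
  have "ennreal (cmod (series_eval c s $ k))
      \<le> (\<Sum>\<^sub>\<infinity>j\<in>UNIV. ennreal (cmod (c k j * monomial_at s j)))"
    by (simp add: series_eval_def norm_infsum_le_infsum_ennreal)
  also have "\<dots> \<le> (\<Sum>\<^sub>\<infinity>j\<in>UNIV. ennreal (cmod (c k j) * a ^ degree_of j))"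
    using assms
    \<comment> \<open>Every family in \<open>ennreal\<close> is summable, so the termwise comparison
      needs no convergence argument.\<close>
    by (intro infsum_mono nonneg_summable_on_complete zero_le)
       (auto simp: norm_mult intro!: ennreal_leI mult_left_mono cmod_monomial_at_le)
  also have "\<dots> \<le> series_norm a c"
    unfolding series_norm_def by (rule Max_ge) auto
  finally show ?thesis .
qed

lemma abs_radial_drift_le:
  assumes "twist_map_on a \<Omega> F" and "complexify z \<in> polydisc a"
    and "G (complexify z) = F (complexify z) + w"
  shows "\<bar>radial_drift G z i\<bar> \<le> cmod (w $ Inl i)"
proof -
  \<comment> \<open>\<open>\<Omega>\<close> is real-valued, so the exponential factor has modulus
    one.\<close>
  have "cmod (F (complexify z) $ Inl i) = cmod (z $ i)"
    using assms(1,2) by (simp add: twist_map_on_def norm_mult)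
  then show ?thesis
    using norm_triangle_ineq3[of "F (complexify z) $ Inl i + w $ Inl i" "F (complexify z) $ Inl i"]
    by (simp add: radial_drift_def orbital_radius_def z_part_def assms(3))
qed

text \<open>Here \<open>b\<close> stands for A a. The order N is chosen so that the base of the
  power is at most exp(-\<tau>); for N = 0 both sides are 1.\<close>

lemma optimal_order_power_le:
  fixes b \<tau> :: real
  assumes "b > 0" and "\<tau> > 0"
    and N: "N = nat \<lfloor>1 / exp 1 * (1 / b) powr (1 / \<tau>)\<rfloor>"
  shows "(b * real N powr \<tau>) ^ N \<le> exp (- \<tau> * real N)"
proof -
  have "real N \<le> 1 / exp 1 * (1 / b) powr (1 / \<tau>)"
    unfolding N by (rule of_nat_floor) simp
  then have "real N powr \<tau> \<le> (exp (- 1) * (1 / b) powr (1 / \<tau>)) powr \<tau>"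
    using assms(2) by (intro powr_mono2) (auto simp: exp_minus field_simps)
  \<comment> \<open>The exponents 1/\<tau> and \<tau> cancel, leaving 1/b from the second
    factor.\<close>
  also have "\<dots> = exp (- \<tau>) / b"
    using assms(1,2) by (simp add: powr_mult powr_powr exp_powr_real)
  finally have "b * real N powr \<tau> \<le> exp (- \<tau>)"
    using assms(1) by (simp add: field_simps)
  then have "(b * real N powr \<tau>) ^ N \<le> exp (- \<tau>) ^ N"
    using assms(1) by (intro power_mono) auto
  also have "\<dots> = exp (- \<tau> * real N)"
    by (simp add: exp_of_nat_mult[symmetric] mult.commute)
  finally show ?thesis .
qed

theorem proposition7:
  fixes F :: "nat \<Rightarrow> complex ^ ('n::finite + 'n) \<Rightarrow> complex ^ ('n::finite + 'n)"
    and R :: "nat \<Rightarrow> ('n::finite + 'n) power_series"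
    and G :: "nat \<Rightarrow> complex ^ ('n::finite + 'n) \<Rightarrow> complex ^ ('n::finite + 'n)"
    and \<Omega> :: "real ^ 'n::finite \<Rightarrow> real ^ 'n::finite"
    and \<epsilon>\<^sub>2 \<rho> \<gamma> \<tau> A a :: real
    and N\<^sub>o\<^sub>p\<^sub>t :: nat
  assumes "\<epsilon>\<^sub>2 > 0" and "\<rho> > 0" and "\<gamma> > 0" and "\<tau> > 0"
    and "A = 4 / (\<rho> * \<gamma>)"
    and "0 < a" and "a \<le> 1 / (A * (2 * exp 1) powr \<tau>)"
    and "N\<^sub>o\<^sub>p\<^sub>t = nat \<lfloor>1 / exp 1 * (1 / (A * a)) powr (1 / \<tau>)\<rfloor>"
    and "twist_map_on a \<Omega> (F N\<^sub>o\<^sub>p\<^sub>t)"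
    and "series_norm a (R N\<^sub>o\<^sub>p\<^sub>t)
           \<le> ennreal (\<epsilon>\<^sub>2 * (2 * a / \<rho>) * (A * a * real N\<^sub>o\<^sub>p\<^sub>t powr \<tau>) ^ N\<^sub>o\<^sub>p\<^sub>t)"
    and "\<And>s. G N\<^sub>o\<^sub>p\<^sub>t s = F N\<^sub>o\<^sub>p\<^sub>t s + series_eval (R N\<^sub>o\<^sub>p\<^sub>t) s"
  shows "(\<forall>z. complexify z \<in> polydisc a \<longrightarrow>
            (\<forall>i. ennreal \<bar>radial_drift (G N\<^sub>o\<^sub>p\<^sub>t) z i\<bar> \<le> series_norm a (R N\<^sub>o\<^sub>p\<^sub>t)))
       \<and> series_norm a (R N\<^sub>o\<^sub>p\<^sub>t) \<le> ennreal (\<epsilon>\<^sub>2 * (2 * a / \<rho>) * exp (- \<tau> * real N\<^sub>o\<^sub>p\<^sub>t))"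
proof (intro conjI allI impI)
  fix z :: "complex ^ 'n" and i :: 'n
  assume z: "complexify z \<in> polydisc a"
  have "ennreal \<bar>radial_drift (G N\<^sub>o\<^sub>p\<^sub>t) z i\<bar>
      \<le> ennreal (cmod (series_eval (R N\<^sub>o\<^sub>p\<^sub>t) (complexify z) $ Inl i))"
    \<comment> \<open>The perturbation \<open>w\<close> is the value of the remainder series at the
      point.\<close>
    by (intro ennreal_leI abs_radial_drift_le[OF assms(9) z] assms(11))
  also have "\<dots> \<le> series_norm a (R N\<^sub>o\<^sub>p\<^sub>t)"
    by (rule cmod_series_eval_le[OF z])
  finally show "ennreal \<bar>radial_drift (G N\<^sub>o\<^sub>p\<^sub>t) z i\<bar> \<le> series_norm a (R N\<^sub>o\<^sub>p\<^sub>t)" .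
next
  have "A * a > 0"
    using assms(2,3,5,6) by simp
  then have "(A * a * real N\<^sub>o\<^sub>p\<^sub>t powr \<tau>) ^ N\<^sub>o\<^sub>p\<^sub>t \<le> exp (- \<tau> * real N\<^sub>o\<^sub>p\<^sub>t)"
    using assms(4,8) by (rule optimal_order_power_le)
  then have "\<epsilon>\<^sub>2 * (2 * a / \<rho>) * (A * a * real N\<^sub>o\<^sub>p\<^sub>t powr \<tau>) ^ N\<^sub>o\<^sub>p\<^sub>t
      \<le> \<epsilon>\<^sub>2 * (2 * a / \<rho>) * exp (- \<tau> * real N\<^sub>o\<^sub>p\<^sub>t)"
    using assms(1,2,6) by (intro mult_left_mono) auto
  then show "series_norm a (R N\<^sub>o\<^sub>p\<^sub>t) \<le> ennreal (\<epsilon>\<^sub>2 * (2 * a / \<rho>) * exp (- \<tau> * real N\<^sub>o\<^sub>p\<^sub>t))"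
    by (intro order_trans[OF assms(10)] ennreal_leI)
qed

end
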